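(* Let $d,\ell\in\mathbb{N}$, let $p_1,\dots,p_\ell$ be distinct primes, and for each $j\in[1,\ell]$ let $e_1^{(j)},\dots,e_d^{(j)}$ be integers with $0\le e_1^{(j)}\le e_2^{(j)}\le\cdots\le e_d^{(j)}$, not all zero, such that $p_j^{e_d^{(j)}}\ge 1+\sum_{i=1}^{d-1}\big(p_j^{e_i^{(j)}}-1\big)$. Let $$G=C_{\prod_{j=1}^{\ell}p_j^{e_1^{(j)}}}\times\cdots\times C_{\prod_{j=1}^{\ell}p_j^{e_d^{(j)}}},$$ and for $j\in[1,\ell]$ put $\varphi(p_j)=\sum_{i=1}^{d-1}p_j^{e_i^{(j)}}-d+1$. Then for every $r\in\mathbb{N}$, $$r\prod_{j=1}^{\ell}p_j^{e_d^{(j)}}+\sum_{i=1}^{d-1}\Big(\prod_{j=1}^{\ell}p_j^{e_i^{(j)}}-1\Big)\le D_r(G)\le r\prod_{j=1}^{\ell}p_j^{e_d^{(j)}}+\sum_{m=1}^{\ell-1}\Big(\Big(\prod_{j=m+1}^{\ell}p_j^{e_d^{(j)}}\Big)\varphi(p_m)\Big)+\varphi(p_\ell).$$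
   Context: All groups are finite abelian, written additively; $C_n$ is the cyclic group of order $n$; $[a,b]=\{x\in\mathbb{Z}:a\le x\le b\}$. A sequence over $G$ is a finite multiset of elements of $G$; subsequences are sub-multisets; disjoint subsequences use distinct terms. A sequence is zero-sum if the sum of its terms is $0$. For $r\in\mathbb{N}$, $D_r(G)$ is the least positive integer $k$ such that every sequence over $G$ of length at least $k$ contains $r$ pairwise disjoint nonempty zero-sum subsequences. *)

theory Defs
  imports "HOL-Algebra.Product_Groups" "HOL-Algebra.FiniteProduct" "HOL-Library.Multiset"
    "HOL-Computational_Algebra.Primes"
begin

(* Groups are HOL-Algebra groups in multiplicative notation: the additive 0 is \<one> and the
   multiple n g is g [^] n. A sequence over G is a multiset with entries in carrier G. *)

definition seq_over :: "('a, 'b) monoid_scheme \<Rightarrow> 'a multiset \<Rightarrow> bool" where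
  "seq_over G S \<longleftrightarrow> set_mset S \<subseteq> carrier G"

definition seq_sum :: "('a, 'b) monoid_scheme \<Rightarrow> 'a multiset \<Rightarrow> 'a" where
  "seq_sum G S = finprod G (\<lambda>g. g [^]\<^bsub>G\<^esub> count S g) (set_mset S)"

definition zero_sum :: "('a, 'b) monoid_scheme \<Rightarrow> 'a multiset \<Rightarrow> bool" where
  "zero_sum G S \<longleftrightarrow> seq_sum G S = \<one>\<^bsub>G\<^esub>"

(* Disjointness concerns terms counted with multiplicity, so sub-multisets T 0, ..., T (r - 1)
   of S are pairwise disjoint as subsequences iff their multiset sum is contained in S. *)
definition has_disjoint_zero_sums :: "('a, 'b) monoid_scheme \<Rightarrow> nat \<Rightarrow> 'a multiset \<Rightarrow> bool" where
  "has_disjoint_zero_sums G r S \<longleftrightarrow>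
    (\<exists>T :: nat \<Rightarrow> 'a multiset.
      (\<forall>i<r. T i \<noteq> {#} \<and> zero_sum G (T i)) \<and> (\<Sum>i<r. T i) \<subseteq># S)"

definition davenport :: "nat \<Rightarrow> ('a, 'b) monoid_scheme \<Rightarrow> nat" where
  "davenport r G =
    (LEAST k. 0 < k \<and> (\<forall>S. seq_over G S \<and> k \<le> size S \<longrightarrow> has_disjoint_zero_sums G r S))"

definition cyclic_product :: "nat \<Rightarrow> (nat \<Rightarrow> nat) \<Rightarrow> (nat \<Rightarrow> int) monoid" where
  "cyclic_product d n = product_group {1..d} (\<lambda>i. integer_mod_group (n i))"

(* q is the prime p_j and a i the exponent e_i^(j). *)
definition phi :: "nat \<Rightarrow> nat \<Rightarrow> (nat \<Rightarrow> nat) \<Rightarrow> int" where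
  "phi d q a = (\<Sum>i=1..d-1. int (q ^ a i)) - int d + 1"

end

theory Submission
  imports Defs "HOL-Library.Disjoint_Sets" "HOL-Number_Theory.Cong"
begin

text \<open>
  Olson's bound for a \<open>p\<close>-group: the indicator of the zero class, a product of indicators of
  \<open>p\<^sup>a\<close> dividing a coordinate, is annihilated modulo \<open>p\<close> by \<open>1 + \<Sum> (p\<^sup>a - 1)\<close> finite differences, whereas
  its alternating sum over the subsums of a family without nonempty zero-sum subfamily would be 1.
  Applied to the group extended by a cyclic factor of order \<open>exp G\<close> whose coordinate counts
  the terms, it yields zero-sum subsequences of length at most \<open>exp G\<close>, which are removed one by one.
  Several primes are combined by \<open>D_r(G) \<le> D_s(K)\<close> for \<open>s = D_r(H)\<close> and an extension \<open>G\<close>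
  of \<open>K\<close> by \<open>H\<close>: the sums of \<open>s\<close> disjoint subsequences that vanish in \<open>K\<close> form a sequence over \<open>H\<close>.
\<close>

section \<open>Finite differences modulo an integer\<close>

text \<open>Known object: modulo \<open>p\<close>, a polynomial map of degree less than
  \<open>k\<close>, since each difference along an arbitrary direction \<open>g\<close> lowers the
  degree by one.\<close>

fun vanishing_diffs :: "int \<Rightarrow> nat \<Rightarrow> (('k \<Rightarrow> int) \<Rightarrow> int) \<Rightarrow> bool" where
  "vanishing_diffs p 0 f \<longleftrightarrow> (\<forall>s. p dvd f s)"
| "vanishing_diffs p (Suc k) f \<longleftrightarrow>
     (\<forall>g. vanishing_diffs p k (\<lambda>s. f (\<lambda>i. s i + g i) - f s))"

lemma vanishing_diffs_if_dvd: "(\<And>s. p dvd f s) \<Longrightarrow> vanishing_diffs p k f"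
  by (induction k arbitrary: f) auto

lemma vanishing_diffs_add:
  "vanishing_diffs p k f \<Longrightarrow> vanishing_diffs p k h \<Longrightarrow> vanishing_diffs p k (\<lambda>s. f s + h s)"
proof (induction k arbitrary: f h)
  case (Suc k)
  show ?case
    unfolding vanishing_diffs.simps
  proof
    fix g
    have "vanishing_diffs p k (\<lambda>s. (f (\<lambda>i. s i + g i) - f s) + (h (\<lambda>i. s i + g i) - h s))"
      using Suc.prems by (intro Suc.IH) auto
    then show "vanishing_diffs p k (\<lambda>s. f (\<lambda>i. s i + g i) + h (\<lambda>i. s i + g i) - (f s + h s))"
      by (simp add: algebra_simps)
  qed
qed auto

lemma vanishing_diffs_shift:
  "vanishing_diffs p k f \<Longrightarrow> vanishing_diffs p k (\<lambda>s. f (\<lambda>i. s i + g i))"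
proof (induction k arbitrary: f)
  case (Suc k)
  show ?case
    unfolding vanishing_diffs.simps
  proof
    fix h
    have "vanishing_diffs p k (\<lambda>s. f (\<lambda>i. (s i + g i) + h i) - f (\<lambda>i. s i + g i))"
      using Suc.prems by (intro Suc.IH) auto
    then show "vanishing_diffs p k (\<lambda>s. f (\<lambda>i. (s i + h i) + g i) - f (\<lambda>i. s i + g i))"
      by (simp add: algebra_simps)
  qed
qed auto

text \<open>By the product rule, the difference of \<open>f * h\<close> is the difference of
  \<open>f\<close> times a shift of \<open>h\<close>, plus \<open>f\<close> times the difference of
  \<open>h\<close>. Each summand has one degree lowered, so induction on \<open>a + b\<close>
  works.\<close>

lemma vanishing_diffs_mult:
  assumes "vanishing_diffs p (Suc a) f" and "vanishing_diffs p (Suc b) h"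
  shows "vanishing_diffs p (Suc (a + b)) (\<lambda>s. f s * h s)"
  using assms
proof (induction "a + b" arbitrary: a b f h rule: less_induct)
  case less
  show ?case
    unfolding vanishing_diffs.simps
  proof
    fix g
    let ?df = "\<lambda>s. f (\<lambda>i. s i + g i) - f s" and ?dh = "\<lambda>s. h (\<lambda>i. s i + g i) - h s"
    have df: "vanishing_diffs p a ?df" and dh: "vanishing_diffs p b ?dh"
      using less.prems by auto
    have 1: "vanishing_diffs p (a + b) (\<lambda>s. ?df s * h (\<lambda>i. s i + g i))"
    proof (cases a)
      \<comment> \<open>No degree is left to lower, but then \<open>?df\<close> itself is divisible
        by \<open>p\<close>.\<close>
      case 0
      then show ?thesis using df by (intro vanishing_diffs_if_dvd) auto
    next
      case (Suc a')
      then have "vanishing_diffs p (Suc (a' + b)) (\<lambda>s. ?df s * h (\<lambda>i. s i + g i))"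
        using df vanishing_diffs_shift[OF less.prems(2), of g] by (intro less.hyps) auto
      then show ?thesis using Suc by simp
    qed
    have 2: "vanishing_diffs p (a + b) (\<lambda>s. f s * ?dh s)"
    proof (cases b)
      case 0
      then show ?thesis using dh by (intro vanishing_diffs_if_dvd) auto
    next
      case (Suc b')
      then have "vanishing_diffs p (Suc (a + b')) (\<lambda>s. f s * ?dh s)"
        using dh less.prems(1) by (intro less.hyps) auto
      then show ?thesis using Suc by simp
    qed
    show "vanishing_diffs p (a + b)
        (\<lambda>s. f (\<lambda>i. s i + g i) * h (\<lambda>i. s i + g i) - f s * h s)"
      using vanishing_diffs_add[OF 1 2] by (simp add: algebra_simps)
  qed
qed

lemma vanishing_diffs_prod:
  assumes "finite K" and "\<And>i. i \<in> K \<Longrightarrow> vanishing_diffs p (Suc (a i)) (f i)"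
  shows "vanishing_diffs p (Suc (\<Sum>i\<in>K. a i)) (\<lambda>s. \<Prod>i\<in>K. f i s)"
  using assms
proof (induction K rule: finite_induct)
  case empty
  then show ?case by simp
next
  case (insert i K)
  then have "vanishing_diffs p (Suc (a i + (\<Sum>i\<in>K. a i))) (\<lambda>s. f i s * (\<Prod>i\<in>K. f i s))"
    by (intro vanishing_diffs_mult) (auto simp del: vanishing_diffs.simps)
  then show ?case using insert.hyps by simp
qed

text \<open>Up to the sign \<open>(-1) ^ card I\<close>, the sum is the iterated difference of
  \<open>f\<close> at \<open>s\<close> along the \<open>card I\<close> directions
  \<open>x t\<close>.\<close>

lemma vanishing_diffs_alternating_sum:
  assumes "finite I" and "vanishing_diffs p (card I) f"
  shows "p dvd (\<Sum>A\<in>Pow I. (-1) ^ card A * f (\<lambda>i. s i + (\<Sum>t\<in>A. x t i)))"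
  using assms
proof (induction I arbitrary: f s rule: finite_induct)
  case (insert t I)
  let ?F = "\<lambda>A. (-1) ^ card A * f (\<lambda>i. s i + (\<Sum>t\<in>A. x t i))"
  let ?df = "\<lambda>s. f (\<lambda>i. s i + x t i) - f s"
  have "p dvd (\<Sum>A\<in>Pow I. (-1) ^ card A * ?df (\<lambda>i. s i + (\<Sum>t\<in>A. x t i)))"
    using insert.prems insert.hyps by (intro insert.IH) auto
  \<comment> \<open>Pairing \<open>A\<close> with \<open>insert t A\<close> turns two summands into
    one difference along \<open>x t\<close>.\<close>
  moreover have "?F A + ?F (insert t A) =
      - ((-1) ^ card A * ?df (\<lambda>i. s i + (\<Sum>t\<in>A. x t i)))" if "A \<in> Pow I" for A
  proof -
    have "finite A" "t \<notin> A" using that insert.hyps by (auto dest: finite_subset)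
    then show ?thesis by (simp add: algebra_simps)
  qed
  moreover have "sum ?F (Pow (insert t I)) = (\<Sum>A\<in>Pow I. ?F A + ?F (insert t A))"
  proof -
    have "inj_on (insert t) (Pow I)" using insert.hyps by (auto simp: inj_on_def)
    moreover have "Pow I \<inter> insert t ` Pow I = {}" using insert.hyps by auto
    ultimately show ?thesis
      using insert.hyps
      by (simp add: Pow_insert sum.union_disjoint sum.reindex sum.distrib)
  qed
  ultimately show ?case by (simp add: sum_negf)
qed auto

section \<open>Iterated differences of periodic functions of one variable\<close>

definition unit_diff :: "(int \<Rightarrow> int) \<Rightarrow> int \<Rightarrow> int" where
  "unit_diff h n = h (n + 1) - h n"

lemma funpow_unit_diff_shift:
  "(unit_diff ^^ k) (\<lambda>n. h (n + c) - h n) = (\<lambda>n. (unit_diff ^^ k) h (n + c) - (unit_diff ^^ k) h n)"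
  by (induction k) (auto simp: unit_diff_def algebra_simps)

text \<open>The binomial expansion of an iterated forward difference: an index shift followed by
  Pascal's rule.\<close>

lemma funpow_unit_diff_eq_sum:
  "(unit_diff ^^ k) h n = (\<Sum>j\<le>k. (-1) ^ (k - j) * int (k choose j) * h (n + int j))"
proof (induction k arbitrary: n)
  case (Suc k)
  have "(unit_diff ^^ Suc k) h n =
      (\<Sum>j\<le>k. (-1) ^ (k - j) * int (k choose j) * h (n + 1 + int j)) -
      (\<Sum>j\<le>k. (-1) ^ (k - j) * int (k choose j) * h (n + int j))"
    by (simp add: unit_diff_def Suc.IH)
  \<comment> \<open>The new summand \<open>j = Suc k\<close> has binomial coefficient 0; it prepares
    the index shift.\<close>
  also have "(\<Sum>j\<le>k. (-1) ^ (k - j) * int (k choose j) * h (n + int j)) =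
      (\<Sum>j\<le>Suc k. (-1) ^ (k - j) * int (k choose j) * h (n + int j))"
    by simp
  also have "\<dots> = (-1) ^ k * h n +
      (\<Sum>j\<le>k. (-1) ^ (k - Suc j) * int (k choose Suc j) * h (n + int (Suc j)))"
    by (subst sum.atMost_Suc_shift) simp
  \<comment> \<open>For \<open>j = k\<close> truncated subtraction gives the wrong exponent, but the
    coefficient is 0 there.\<close>
  also have "(\<Sum>j\<le>k. (-1) ^ (k - Suc j) * int (k choose Suc j) * h (n + int (Suc j))) =
      (\<Sum>j\<le>k. - ((-1) ^ (k - j) * int (k choose Suc j) * h (n + int (Suc j))))"
  proof (rule sum.cong)
    fix j assume "j \<in> {..k}"
    then show "(-1) ^ (k - Suc j) * int (k choose Suc j) * h (n + int (Suc j)) =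
        - ((-1) ^ (k - j) * int (k choose Suc j) * h (n + int (Suc j)))"
      by (cases "j = k") (auto simp: Suc_diff_Suc[symmetric] simp del: Suc_diff_Suc)
  qed simp
  finally show ?case
    by (subst sum.atMost_Suc_shift) (simp add: algebra_simps sum.distrib sum_negf)
qed auto

text \<open>With \<open>q = p ^ e\<close>, the identity
  \<open>j * (q choose j) = q * (q - 1 choose (j - 1))\<close> shows that a binomial coefficient
  coprime to \<open>q\<close> would force \<open>q\<close> to divide \<open>j\<close>.\<close>

lemma prime_dvd_prime_power_choose:
  fixes p :: nat
  assumes "prime p" and "0 < j" and "j < p ^ e"
  shows "p dvd (p ^ e choose j)"
proof (rule ccontr)
  assume "\<not> p dvd (p ^ e choose j)"
  then have "coprime (p ^ e) (p ^ e choose j)"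
    using assms(1) by (simp add: prime_imp_coprime)
  moreover have "p ^ e dvd j * (p ^ e choose j)"
    using times_binomial_minus1_eq[OF assms(2), of "p ^ e"] by simp
  ultimately have "p ^ e dvd j"
    by (simp add: coprime_dvd_mult_left_iff)
  then show False using assms by (auto dest: dvd_imp_le)
qed

text \<open>Modulo \<open>p\<close> only the two outer terms of the binomial expansion survive, and
  periodicity merges them into one multiple of \<open>h n\<close>.\<close>

lemma prime_dvd_funpow_unit_diff_periodic:
  fixes p :: nat
  assumes "prime p" and periodic: "\<And>n. h (n + int (p ^ e)) = h n"
  shows "int p dvd (unit_diff ^^ (p ^ e)) h n"
proof (cases "e = 0")
  case True
  then show ?thesis using periodic by (simp add: unit_diff_def)
next
  case False
  let ?q = "p ^ e"
  let ?c = "\<lambda>j. (-1) ^ (?q - j) * int (?q choose j) * h (n + int j)"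
  have q: "?q > 0" using assms(1) by (simp add: prime_gt_0_nat)
  have "{..?q} = insert 0 (insert ?q {0<..<?q})" using q by auto
  then have "(unit_diff ^^ ?q) h n = ?c 0 + (?c ?q + sum ?c {0<..<?q})"
    using q by (simp add: funpow_unit_diff_eq_sum)
  also have "?c 0 + (?c ?q + sum ?c {0<..<?q}) = ((-1) ^ ?q + 1) * h n + sum ?c {0<..<?q}"
    using periodic[of n] by (simp add: algebra_simps)
  also have "int p dvd \<dots>"
  proof (rule dvd_add)
    \<comment> \<open>The factor is 0 for odd \<open>p\<close>; for \<open>p = 2\<close> it is 2,
      because \<open>e\<close> is nonzero and the exponent is even.\<close>
    have "int p dvd (-1) ^ ?q + 1"
    proof (cases "p = 2")
      case True then show ?thesis using False by simp
    next
      case odd: False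
      then have "odd p" using assms(1) primes_dvd_imp_eq two_is_prime_nat by blast
      then show ?thesis by simp
    qed
    then show "int p dvd ((-1) ^ ?q + 1) * h n" by simp
    show "int p dvd sum ?c {0<..<?q}"
      using prime_dvd_prime_power_choose[OF assms(1)]
      by (intro dvd_sum) (auto intro!: dvd_mult dvd_mult2)
  qed
  finally show ?thesis .
qed

text \<open>Passage from unit steps to arbitrary ones: if the next unit difference vanishes modulo
  \<open>p\<close>, the \<open>k\<close>-th one is constant modulo \<open>p\<close>, so its
  difference with any step \<open>c\<close> vanishes too.\<close>

lemma vanishing_diffs_coordinate:
  assumes "\<And>n. p dvd (unit_diff ^^ k) h n"
  shows "vanishing_diffs p k (\<lambda>s. h (s i))"
  using assms
proof (induction k arbitrary: h)
  case (Suc k)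
  have step: "[(unit_diff ^^ k) h (n + 1) = (unit_diff ^^ k) h n] (mod p)" for n
    using Suc.prems[of n] by (simp add: unit_diff_def[of "(unit_diff ^^ k) h"] cong_iff_dvd_diff)
  have const: "[(unit_diff ^^ k) h (n + c) = (unit_diff ^^ k) h n] (mod p)" for n c
  proof (induction c rule: int_induct[where k = 0])
    case (step1 c)
    then show ?case using step[of "n + c"] by (metis add.assoc cong_trans)
  next
    case (step2 c)
    then show ?case using step[of "n + (c - 1)"]
      by (metis add.assoc cong_sym cong_trans diff_add_cancel)
  qed simp
  show ?case
    unfolding vanishing_diffs.simps
  proof
    fix g
    \<comment> \<open>The difference along \<open>g\<close> is again a function of coordinate
      \<open>i\<close> alone, with fixed step \<open>g i\<close>, so the induction hypothesis
      applies to it.\<close>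
    show "vanishing_diffs p k (\<lambda>s. h (s i + g i) - h (s i))"
      using const by (intro Suc.IH) (simp add: funpow_unit_diff_shift cong_iff_dvd_diff)
  qed
qed auto

section \<open>Zero-sum subfamilies in p-groups\<close>

text \<open>Integer vectors represent elements of the product of cyclic groups of orders
  \<open>n i\<close>; sets of indices keep equal terms apart.\<close>

definition zero_sum_index_set :: "'k set \<Rightarrow> ('k \<Rightarrow> nat) \<Rightarrow> ('t \<Rightarrow> 'k \<Rightarrow> int) \<Rightarrow> 't set \<Rightarrow> bool" where
  "zero_sum_index_set K n x A \<longleftrightarrow> A \<noteq> {} \<and> (\<forall>i\<in>K. int (n i) dvd (\<Sum>t\<in>A. x t i))"

text \<open>Each coordinate indicator has period \<open>p ^ a i\<close>, hence degree at most
  \<open>p ^ a i - 1\<close> modulo \<open>p\<close>; the degree of their product \<open>f\<close>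
  is therefore below \<open>card J\<close>.\<close>

lemma olson:
  fixes p :: nat and a :: "'k \<Rightarrow> nat" and x :: "'t \<Rightarrow> 'k \<Rightarrow> int"
  assumes "prime p" and "finite K" and "finite I"
    and card: "card I \<ge> 1 + (\<Sum>i\<in>K. p ^ a i - 1)"
  obtains A where "A \<subseteq> I" and "zero_sum_index_set K (\<lambda>i. p ^ a i) x A"
proof -
  obtain J where J: "J \<subseteq> I" "card J = Suc (\<Sum>i\<in>K. p ^ a i - 1)"
    using obtain_subset_with_card_n[OF card] by auto
  then have "finite J" using assms(3) finite_subset by blast
  define f :: "('k \<Rightarrow> int) \<Rightarrow> int"
    where "f s = (\<Prod>i\<in>K. of_bool (int (p ^ a i) dvd s i))" for s
  have f_eq: "f s = of_bool (\<forall>i\<in>K. int (p ^ a i) dvd s i)" for s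
    unfolding f_def using assms(2) by (auto simp: of_bool_def)
  have "vanishing_diffs (int p) (Suc (p ^ a i - 1)) (\<lambda>s. of_bool (int (p ^ a i) dvd s i))" for i :: 'k
  proof -
    have "vanishing_diffs (int p) (p ^ a i) (\<lambda>s. of_bool (int (p ^ a i) dvd s i))"
      using assms(1)
      by (intro vanishing_diffs_coordinate prime_dvd_funpow_unit_diff_periodic) (auto simp: dvd_add_left_iff)
    then show ?thesis using assms(1) by (simp add: prime_gt_0_nat)
  qed
  then have "vanishing_diffs (int p) (card J) f"
    unfolding J(2) f_def using assms(2) by (intro vanishing_diffs_prod)
  from vanishing_diffs_alternating_sum[OF \<open>finite J\<close> this, of "\<lambda>_. 0" x]
  have dvd: "int p dvd (\<Sum>A\<in>Pow J. (-1) ^ card A * f (\<lambda>i. \<Sum>t\<in>A. x t i))" by simp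
  have "\<exists>A\<in>Pow J. zero_sum_index_set K (\<lambda>i. p ^ a i) x A"
  proof (rule ccontr)
    assume none: "\<not> ?thesis"
    \<comment> \<open>\<open>f\<close> vanishes at the sum of every nonempty \<open>A\<close> and
      equals 1 at the empty sum.\<close>
    have "(\<Sum>A\<in>Pow J. (-1) ^ card A * f (\<lambda>i. \<Sum>t\<in>A. x t i)) =
        (\<Sum>A\<in>Pow J. if A = {} then 1 else 0)"
      using none by (intro sum.cong) (auto simp: f_eq zero_sum_index_set_def)
    also have "\<dots> = 1" using \<open>finite J\<close> by simp
    finally show False using dvd assms(1) not_prime_1 by auto
  qed
  then show ?thesis using that J by auto
qed

text \<open>An extra coordinate counting terms makes the length of a zero-sum set a multiple of
  \<open>n = p ^ a d\<close>. Fewer than \<open>3 * n\<close> indices are available, so the length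
  is \<open>n\<close> or \<open>2 * n\<close>; in the latter case the set splits into two zero-sum
  sets, one of them short.\<close>

lemma short_zero_sum:
  fixes p d :: nat and a :: "nat \<Rightarrow> nat" and x :: "'t \<Rightarrow> nat \<Rightarrow> int"
  defines "\<phi> \<equiv> \<Sum>i=1..d-1. p ^ a i - 1"
  assumes "prime p" and "1 \<le> d" and "p ^ a d \<ge> 1 + \<phi>"
    and "finite I" and card: "card I \<ge> 2 * p ^ a d - 1 + \<phi>"
  obtains A where "A \<subseteq> I" and "zero_sum_index_set {1..d} (\<lambda>i. p ^ a i) x A" and "card A \<le> p ^ a d"
proof -
  let ?n = "p ^ a d"
  obtain J where J: "J \<subseteq> I" "card J = 2 * ?n - 1 + \<phi>"
    using obtain_subset_with_card_n[OF card] by auto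
  have "finite J" using J assms(5) finite_subset by blast
  have split: "{1..d} = insert d {1..d-1}" using assms(3) by auto
  have sum_d: "(\<Sum>i\<in>{1..d}. p ^ a i - 1) = ?n - 1 + \<phi>"
    unfolding split \<phi>_def using assms(3) by (subst sum.insert) auto
  \<comment> \<open>Index 0 lies outside \<open>{1..d}\<close> and serves as the counting
    coordinate, with all entries 1.\<close>
  define a' x' where "a' i = (if i = 0 then a d else a i)"
    and "x' t i = (if i = 0 then 1 else x t i)" for i t
  have "(\<Sum>i\<in>{1..d}. p ^ a' i - 1) = (\<Sum>i\<in>{1..d}. p ^ a i - 1)"
    by (intro sum.cong) (auto simp: a'_def)
  then have "(\<Sum>i\<in>insert 0 {1..d}. p ^ a' i - 1) = 2 * (?n - 1) + \<phi>"
    using sum_d by (subst sum.insert) (simp_all add: a'_def del: One_nat_def)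
  then have "card J \<ge> 1 + (\<Sum>i\<in>insert 0 {1..d}. p ^ a' i - 1)"
    using J assms(4) by linarith
  then obtain A where A: "A \<subseteq> J" "zero_sum_index_set (insert 0 {1..d}) (\<lambda>i. p ^ a' i) x' A"
    by (rule olson[OF assms(2) _ \<open>finite J\<close>, rotated]) auto
  have "(\<Sum>t\<in>A. x' t i) = (\<Sum>t\<in>A. x t i)" if "i \<in> {1..d}" for i
    using that by (simp add: x'_def)
  with A(2) have zA: "zero_sum_index_set {1..d} (\<lambda>i. p ^ a i) x A"
    unfolding zero_sum_index_set_def by (force simp: a'_def)
  have "?n dvd card A"
    using A(2) unfolding zero_sum_index_set_def by (simp add: a'_def x'_def flip: of_nat_power)
  then obtain c where c: "card A = ?n * c" ..
  have fA: "finite A" using A \<open>finite J\<close> finite_subset by blast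
  have "card A \<le> 2 * ?n - 1 + \<phi>" using A J \<open>finite J\<close> card_mono by metis
  then have "?n * c < ?n * 3" using c assms(4) by linarith
  then have "c < 3" by simp
  show ?thesis
  proof (cases "c \<le> 1")
    case True
    then have "card A \<le> ?n" using c by simp
    then show ?thesis using that zA A J by blast
  next
    case False
    then have cA: "card A = 2 * ?n" using c \<open>c < 3\<close> by (auto simp: numeral_3_eq_3 less_Suc_eq)
    \<comment> \<open>\<open>?n + \<phi>\<close> is the threshold of \<open>olson\<close> for the
      original \<open>d\<close> coordinates, and it is less than \<open>2 * ?n\<close>, so the
      zero-sum set found inside is proper.\<close>
    have "?n + \<phi> \<le> card A" using cA assms(4) by linarith
    then obtain A' where A': "A' \<subseteq> A" "card A' = ?n + \<phi>"
      using obtain_subset_with_card_n by metis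
    have "card A' \<ge> 1 + (\<Sum>i\<in>{1..d}. p ^ a i - 1)"
      unfolding sum_d using A' assms(4) by linarith
    then obtain B where B: "B \<subseteq> A'" "zero_sum_index_set {1..d} (\<lambda>i. p ^ a i) x B"
      by (rule olson[OF assms(2) _ finite_subset[OF A'(1) fA], rotated]) auto
    have BA: "B \<subseteq> A" using B A' by blast
    have "card B \<le> card A'" using B A' fA card_mono finite_subset by metis
    then have "card B < card A" using A' cA assms(4) by linarith
    then have "A - B \<noteq> {}" using BA by auto
    moreover have "int (p ^ a i) dvd (\<Sum>t\<in>A-B. x t i)" if "i \<in> {1..d}" for i
      unfolding sum_diff[OF fA BA]
      using zA B(2) that unfolding zero_sum_index_set_def by (intro dvd_diff) auto
    ultimately have zAB: "zero_sum_index_set {1..d} (\<lambda>i. p ^ a i) x (A - B)"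
      unfolding zero_sum_index_set_def by auto
    show ?thesis
    proof (cases "card B \<le> ?n")
      case True
      then show ?thesis using that B A' A J by blast
    next
      case False
      have "card (A - B) = card A - card B" using BA fA finite_subset card_Diff_subset by metis
      then have "card (A - B) \<le> ?n" using False cA by linarith
      then show ?thesis using that zAB A J by blast
    qed
  qed
qed

section \<open>Bounds for prime powers and for extensions\<close>

text \<open>The property \<open>D_r \<le> k\<close>, stated for indexed families of integer vectors: unlike residue
  vectors, these can be divided by the moduli, which replaces the Chinese remainder theorem.\<close>

definition davenport_bound :: "'k set \<Rightarrow> ('k \<Rightarrow> nat) \<Rightarrow> nat \<Rightarrow> nat \<Rightarrow> bool" where
  "davenport_bound K n r k \<longleftrightarrow>
    (\<forall>(I :: nat set) x. finite I \<longrightarrow> k \<le> card I \<longrightarrow>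
      (\<exists>A :: nat \<Rightarrow> nat set. (\<forall>s<r. A s \<subseteq> I \<and> zero_sum_index_set K n x (A s)) \<and>
        disjoint_family_on A {..<r}))"

text \<open>While at least two sets are still to be found, there are enough indices for a short one,
  and its removal costs at most \<open>p ^ a d\<close> of them.\<close>

lemma davenport_bound_prime_power:
  fixes p d r :: nat and a :: "nat \<Rightarrow> nat"
  defines "\<phi> \<equiv> \<Sum>i=1..d-1. p ^ a i - 1"
  assumes "prime p" and "1 \<le> d" and "p ^ a d \<ge> 1 + \<phi>"
  shows "davenport_bound {1..d} (\<lambda>i. p ^ a i) r (r * p ^ a d + \<phi>)"
  unfolding davenport_bound_def
proof (intro allI impI)
  fix I :: "nat set" and x :: "nat \<Rightarrow> nat \<Rightarrow> int"
  assume "finite I" and "r * p ^ a d + \<phi> \<le> card I"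
  then show "\<exists>A. (\<forall>s<r. A s \<subseteq> I \<and> zero_sum_index_set {1..d} (\<lambda>i. p ^ a i) x (A s)) \<and>
        disjoint_family_on A {..<r}"
  proof (induction r arbitrary: I)
    case 0
    then show ?case by (simp add: disjoint_family_on_def)
  next
    case (Suc r)
    let ?n = "p ^ a d"
    \<comment> \<open>For \<open>r = 0\<close> nothing is extracted afterwards, so the length of
      \<open>B\<close> is irrelevant and \<open>olson\<close> suffices.\<close>
    have "\<exists>B\<subseteq>I. zero_sum_index_set {1..d} (\<lambda>i. p ^ a i) x B \<and> (r = 0 \<or> card B \<le> ?n)"
    proof (cases r)
      case 0
      have split: "{1..d} = insert d {1..d-1}" using assms(3) by auto
      have "(\<Sum>i\<in>{1..d}. p ^ a i - 1) = ?n - 1 + \<phi>"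
        unfolding split \<phi>_def using assms(3) by (subst sum.insert) auto
      then have "card I \<ge> 1 + (\<Sum>i\<in>{1..d}. p ^ a i - 1)" using 0 Suc.prems assms(4) by simp
      then obtain B where "B \<subseteq> I" "zero_sum_index_set {1..d} (\<lambda>i. p ^ a i) x B"
        by (rule olson[OF assms(2) finite_atLeastAtMost Suc.prems(1)])
      then show ?thesis using 0 by blast
    next
      case (Suc r')
      then have "card I \<ge> 2 * ?n - 1 + \<phi>" using Suc.prems by simp
      then obtain B where "B \<subseteq> I" "zero_sum_index_set {1..d} (\<lambda>i. p ^ a i) x B" "card B \<le> ?n"
        unfolding \<phi>_def
        by (rule short_zero_sum[OF assms(2,3) assms(4)[unfolded \<phi>_def] Suc.prems(1)])
      then show ?thesis by blast
    qed
    then obtain B where B: "B \<subseteq> I" "zero_sum_index_set {1..d} (\<lambda>i. p ^ a i) x B"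
      "r = 0 \<or> card B \<le> ?n" by blast
    have "\<exists>A. (\<forall>s<r. A s \<subseteq> I - B \<and> zero_sum_index_set {1..d} (\<lambda>i. p ^ a i) x (A s)) \<and>
        disjoint_family_on A {..<r}"
    proof (cases "r = 0")
      case True
      then show ?thesis by (simp add: disjoint_family_on_def)
    next
      case False
      have "card (I - B) = card I - card B"
        using B Suc.prems finite_subset card_Diff_subset by metis
      then have "r * ?n + \<phi> \<le> card (I - B)" using B False Suc.prems by simp
      then show ?thesis using Suc.prems by (intro Suc.IH) auto
    qed
    then obtain A where A: "\<And>s. s < r \<Longrightarrow> A s \<subseteq> I - B \<and> zero_sum_index_set {1..d} (\<lambda>i. p ^ a i) x (A s)"
      "disjoint_family_on A {..<r}" by blast
    show ?case
    proof (intro exI conjI)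
      show "\<forall>s<Suc r. (A(r := B)) s \<subseteq> I \<and> zero_sum_index_set {1..d} (\<lambda>i. p ^ a i) x ((A(r := B)) s)"
        using A(1) B by (auto simp: less_Suc_eq)
      show "disjoint_family_on (A(r := B)) {..<Suc r}"
        unfolding disjoint_family_on_def
      proof (intro ballI impI)
        fix s s' assume "s \<in> {..<Suc r}" "s' \<in> {..<Suc r}" "s \<noteq> s'"
        then consider "s < r" "s' < r" | "s < r" "s' = r" | "s = r" "s' < r"
          by (auto simp: less_Suc_eq)
        then show "(A(r := B)) s \<inter> (A(r := B)) s' = {}"
        proof cases
          case 1
          then show ?thesis using A(2) \<open>s \<noteq> s'\<close> by (auto simp: disjoint_family_on_def)
        next
          case 2
          then show ?thesis using A(1)[of s] by auto
        next
          case 3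
          then show ?thesis using A(1)[of s'] by auto
        qed
      qed
    qed
  qed
qed

text \<open>The \<open>k'\<close> disjoint sets that vanish modulo \<open>q\<close> have sums
  divisible by \<open>q\<close>. The quotients form a new family of \<open>k'\<close> vectors, and a
  zero-sum set modulo \<open>n\<close> among these gives a union that vanishes modulo
  \<open>n i * q i\<close>.\<close>

lemma davenport_bound_mult:
  assumes "davenport_bound K n r k'" and "davenport_bound K q k' k"
    and "\<And>i. i \<in> K \<Longrightarrow> 0 < q i"
  shows "davenport_bound K (\<lambda>i. n i * q i) r k"
  unfolding davenport_bound_def
proof (intro allI impI)
  fix I :: "nat set" and x :: "nat \<Rightarrow> 'a \<Rightarrow> int"
  assume I: "finite I" "k \<le> card I"
  with assms(2) obtain A :: "nat \<Rightarrow> nat set" where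
    A: "\<And>s. s < k' \<Longrightarrow> A s \<subseteq> I \<and> zero_sum_index_set K q x (A s)" "disjoint_family_on A {..<k'}"
    unfolding davenport_bound_def by meson
  define y where "y s i = (\<Sum>t\<in>A s. x t i) div int (q i)" for s i
  have y: "(\<Sum>t\<in>A s. x t i) = int (q i) * y s i" if "s < k'" "i \<in> K" for s i
    using A(1)[OF that(1)] that(2) unfolding zero_sum_index_set_def y_def by simp
  obtain B :: "nat \<Rightarrow> nat set" where
    B: "\<And>s. s < r \<Longrightarrow> B s \<subseteq> {..<k'} \<and> zero_sum_index_set K n y (B s)" "disjoint_family_on B {..<r}"
    using assms(1)[unfolded davenport_bound_def, rule_format, of "{..<k'}" y] by auto
  define C where "C s = \<Union> (A ` B s)" for s
  show "\<exists>C. (\<forall>s<r. C s \<subseteq> I \<and> zero_sum_index_set K (\<lambda>i. n i * q i) x (C s)) \<and>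
      disjoint_family_on C {..<r}"
  proof (intro exI conjI allI impI)
    fix s assume s: "s < r"
    then have Bs: "B s \<subseteq> {..<k'}" "B s \<noteq> {}" using B unfolding zero_sum_index_set_def by auto
    have AB: "A u \<subseteq> I" "A u \<noteq> {}" if "u \<in> B s" for u
      using A(1)[of u] Bs that unfolding zero_sum_index_set_def by auto
    show "C s \<subseteq> I" unfolding C_def using AB by auto
    have "C s \<noteq> {}" unfolding C_def using AB Bs by auto
    moreover have "int (n i * q i) dvd (\<Sum>t\<in>C s. x t i)" if i: "i \<in> K" for i
    proof -
      \<comment> \<open>Disjointness of the sets \<open>A u\<close> splits the sum over their
        union.\<close>
      have "(\<Sum>t\<in>C s. x t i) = (\<Sum>u\<in>B s. \<Sum>t\<in>A u. x t i)"
        unfolding C_def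
      proof (rule sum.UNION_disjoint)
        show "finite (B s)" using Bs finite_subset by blast
        show "\<forall>u\<in>B s. finite (A u)" using finite_subset[OF AB(1) I(1)] by blast
        show "\<forall>u\<in>B s. \<forall>v\<in>B s. u \<noteq> v \<longrightarrow> A u \<inter> A v = {}"
          using disjoint_family_onD[OF A(2)] Bs(1) by (meson subsetD)
      qed
      also have "\<dots> = (\<Sum>u\<in>B s. int (q i) * y u i)"
        using y i Bs by (intro sum.cong) auto
      also have "\<dots> = int (q i) * (\<Sum>u\<in>B s. y u i)" by (simp add: sum_distrib_left)
      finally show ?thesis
        using B(1)[OF s] i unfolding zero_sum_index_set_def by (simp add: mult.commute mult_dvd_mono)
    qed
    ultimately show "zero_sum_index_set K (\<lambda>i. n i * q i) x (C s)"
      unfolding zero_sum_index_set_def by blast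
  next
    show "disjoint_family_on C {..<r}"
      unfolding disjoint_family_on_def
    proof (intro ballI impI)
      fix s s' assume s: "s \<in> {..<r}" "s' \<in> {..<r}" "s \<noteq> s'"
      then have B_disj: "B s \<inter> B s' = {}" "B s \<subseteq> {..<k'}" "B s' \<subseteq> {..<k'}"
        using B unfolding disjoint_family_on_def by auto
      have "A v \<inter> A w = {}" if "v \<in> B s" "w \<in> B s'" for v w
        using disjoint_family_onD[OF A(2), of v w] that B_disj by blast
      then show "C s \<inter> C s' = {}" unfolding C_def by blast
    qed
  qed
qed

section \<open>Sequences over products of cyclic groups\<close>

lemma (in comm_monoid) seq_sum_add_mset:
  assumes "seq_over G S" and "g \<in> carrier G"
  shows "seq_sum G (add_mset g S) = g \<otimes> seq_sum G S"
proof -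
  let ?F = "insert g (set_mset S)"
  have F: "finite ?F" "?F \<subseteq> carrier G" using assms by (auto simp: seq_over_def)
  \<comment> \<open>Both sums are taken over the support enlarged by \<open>g\<close>, where a term
    of count 0 contributes \<open>\<one>\<close>; the extra copy of \<open>g\<close> becomes a
    separate factor.\<close>
  have "seq_sum G (add_mset g S) = (\<Otimes>h\<in>?F. (if g = h then h else \<one>) \<otimes> h [^] count S h)"
    unfolding seq_sum_def set_mset_add_mset_insert
  proof (rule finprod_cong')
    fix h assume "h \<in> ?F"
    then have "h \<in> carrier G" using F by blast
    then show "h [^] count (add_mset g S) h = (if g = h then h else \<one>) \<otimes> h [^] count S h"
      by (simp add: m_comm)
  next
    show "(\<lambda>h. (if g = h then h else \<one>) \<otimes> h [^] count S h) \<in> ?F \<rightarrow> carrier G"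
      using F by (intro Pi_I m_closed nat_pow_closed) auto
  qed simp
  also have "\<dots> = (\<Otimes>h\<in>?F. if g = h then h else \<one>) \<otimes> (\<Otimes>h\<in>?F. h [^] count S h)"
    using F by (intro finprod_multf) (auto split: if_splits)
  also have "(\<Otimes>h\<in>?F. if g = h then h else \<one>) = g"
    using finprod_singleton[of g ?F "\<lambda>h. h"] F by auto
  also have "(\<Otimes>h\<in>?F. h [^] count S h) = seq_sum G S"
    unfolding seq_sum_def using F
    by (intro finprod_mono_neutral_cong_right) (auto simp: not_in_iff)
  finally show ?thesis .
qed

lemma comm_group_cyclic_product: "comm_group (cyclic_product d n)"
proof -
  interpret group "cyclic_product d n"
    unfolding cyclic_product_def by (rule product_group) simp
  show ?thesis
    by (rule group_comm_groupI) (auto simp: cyclic_product_def add.commute)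
qed

lemma seq_sum_cyclic_product:
  assumes "seq_over (cyclic_product d n) S"
  shows "seq_sum (cyclic_product d n) S = (\<lambda>i\<in>{1..d}. (\<Sum>g\<in>#S. g i) mod int (n i))"
  using assms
proof (induction S)
  case empty
  interpret comm_group "cyclic_product d n" by (rule comm_group_cyclic_product)
  have "seq_sum (cyclic_product d n) {#} = \<one>\<^bsub>cyclic_product d n\<^esub>"
    by (simp add: seq_sum_def)
  then show ?case by (simp add: cyclic_product_def)
next
  case (add g S)
  interpret comm_group "cyclic_product d n" by (rule comm_group_cyclic_product)
  have "seq_sum (cyclic_product d n) (add_mset g S)
      = g \<otimes>\<^bsub>cyclic_product d n\<^esub> (\<lambda>i\<in>{1..d}. (\<Sum>g\<in>#S. g i) mod int (n i))"
    using add by (simp add: seq_sum_add_mset seq_over_def del: restrict_apply)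
  also have "\<dots> = (\<lambda>i\<in>{1..d}. (\<Sum>g\<in>#add_mset g S. g i) mod int (n i))"
    by (auto simp: cyclic_product_def mod_simps intro!: restrict_ext)
  finally show ?case .
qed

text \<open>The bridge from the group to divisibility of integer coordinate sums, the form used by
  \<open>zero_sum_index_set\<close>.\<close>

lemma zero_sum_cyclic_product_iff:
  assumes "seq_over (cyclic_product d n) S"
  shows "zero_sum (cyclic_product d n) S \<longleftrightarrow> (\<forall>i\<in>{1..d}. int (n i) dvd (\<Sum>g\<in>#S. g i))"
  unfolding zero_sum_def seq_sum_cyclic_product[OF assms]
  by (auto simp: cyclic_product_def fun_eq_iff restrict_def dvd_eq_mod_eq_0)

lemma sum_image_mset_mset_set:
  fixes A :: "nat \<Rightarrow> 'a set"
  assumes "\<And>s. s < r \<Longrightarrow> finite (A s)" and "disjoint_family_on A {..<r}"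
  shows "(\<Sum>s<r. image_mset f (mset_set (A s))) = image_mset f (mset_set (\<Union>s<r. A s))"
  using assms
proof (induction r)
  case (Suc r)
  have "(\<Union>s<r. A s) \<inter> A r = {}"
  proof -
    have "A s \<inter> A r = {}" if "s < r" for s
      using disjoint_family_onD[OF Suc.prems(2), of s r] that by simp
    then show ?thesis by blast
  qed
  then have "mset_set ((\<Union>s<r. A s) \<union> A r) = mset_set (\<Union>s<r. A s) + mset_set (A r)"
    using Suc.prems(1) by (intro mset_set_Union) auto
  moreover have "disjoint_family_on A {..<r}"
    using Suc.prems(2) by (rule disjoint_family_on_mono[rotated]) auto
  ultimately show ?case
    using Suc by (simp add: lessThan_Suc Un_commute add.commute)
qed simp

lemma has_disjoint_zero_sums_if_davenport_bound:
  assumes "davenport_bound {1..d} n r k" and "seq_over (cyclic_product d n) S" and "k \<le> size S"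
  shows "has_disjoint_zero_sums (cyclic_product d n) r S"
proof -
  \<comment> \<open>Listing the terms gives equal ones different indices, so disjoint index sets
    select disjoint subsequences.\<close>
  obtain xs where xs: "mset xs = S" using ex_mset by blast
  let ?I = "{..<length xs}"
  have "k \<le> card ?I" using assms(3) xs by auto
  then obtain A :: "nat \<Rightarrow> nat set" where
    A: "\<And>s. s < r \<Longrightarrow> A s \<subseteq> ?I \<and> zero_sum_index_set {1..d} n ((!) xs) (A s)"
       "disjoint_family_on A {..<r}"
    using assms(1)[unfolded davenport_bound_def, rule_format, of ?I "(!) xs"] by auto
  have fin: "finite (A s)" if "s < r" for s using A(1)[OF that] finite_subset by blast
  define T where "T s = image_mset ((!) xs) (mset_set (A s))" for s
  have S_eq: "S = image_mset ((!) xs) (mset_set ?I)"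
    by (metis xs mset_map map_nth mset_upt atLeast0LessThan)
  have "T s \<noteq> {#} \<and> zero_sum (cyclic_product d n) (T s)" if s: "s < r" for s
  proof
    show "T s \<noteq> {#}"
      using A(1)[OF s] fin[OF s] by (auto simp: T_def zero_sum_index_set_def mset_set_empty_iff)
    have "T s \<subseteq># S"
      unfolding T_def S_eq using A(1)[OF s] by (intro image_mset_subseteq_mono) (simp add: subset_imp_msubset_mset_set)
    then have "seq_over (cyclic_product d n) (T s)"
      using assms(2) set_mset_mono unfolding seq_over_def by blast
    moreover have "(\<Sum>g\<in>#T s. g i) = (\<Sum>t\<in>A s. (xs ! t) i)" for i
      by (simp add: T_def sum_unfold_sum_mset image_mset.compositionality comp_def)
    ultimately show "zero_sum (cyclic_product d n) (T s)"
      using A(1)[OF s] by (simp add: zero_sum_cyclic_product_iff zero_sum_index_set_def)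
  qed
  moreover have "(\<Sum>s<r. T s) \<subseteq># S"
  proof -
    have "(\<Sum>s<r. T s) = image_mset ((!) xs) (mset_set (\<Union>s<r. A s))"
      unfolding T_def using fin A(2) by (rule sum_image_mset_mset_set)
    then show ?thesis
      unfolding S_eq using A(1) by (auto intro!: image_mset_subseteq_mono subset_imp_msubset_mset_set)
  qed
  ultimately show ?thesis unfolding has_disjoint_zero_sums_def by blast
qed

section \<open>Upper and lower bounds for the Davenport constant\<close>

lemma davenport_le:
  assumes "davenport_bound {1..d} n r k" and "0 < k"
  shows "davenport r (cyclic_product d n) \<le> k"
  unfolding davenport_def using assms has_disjoint_zero_sums_if_davenport_bound
  by (intro Least_le) blast

lemma has_disjoint_zero_sums_davenport:
  assumes "davenport_bound {1..d} n r k" and "seq_over (cyclic_product d n) S"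
    and "davenport r (cyclic_product d n) \<le> size S"
  shows "has_disjoint_zero_sums (cyclic_product d n) r S"
proof -
  \<comment> \<open>A witness that the minimum is attained; \<open>Suc k\<close> is positive even
    for \<open>k = 0\<close>.\<close>
  have "0 < Suc k \<and> (\<forall>S. seq_over (cyclic_product d n) S \<and> Suc k \<le> size S \<longrightarrow>
      has_disjoint_zero_sums (cyclic_product d n) r S)"
    using has_disjoint_zero_sums_if_davenport_bound[OF assms(1)] by simp
  from LeastI[of "\<lambda>k. 0 < k \<and> (\<forall>S. seq_over (cyclic_product d n) S \<and> k \<le> size S \<longrightarrow>
      has_disjoint_zero_sums (cyclic_product d n) r S)", OF this]
  show ?thesis using assms(2,3) unfolding davenport_def by blast
qed

lemma coordinate_sum_sum:
  fixes T :: "'s \<Rightarrow> ('k \<Rightarrow> int) multiset"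
  shows "(\<Sum>g\<in>#(\<Sum>s\<in>F. T s). g i) = (\<Sum>s\<in>F. \<Sum>g\<in>#T s. g i)"
  by (induction F rule: infinite_finite_induct) auto

text \<open>The extremal sequence consists of \<open>r n\<^sub>d - 1\<close> copies of the last basis vector and
  \<open>n\<^sub>i - 1\<close> copies of each other one: a zero-sum subsequence can only use the last vector, at least
  \<open>n\<^sub>d\<close> times.\<close>

lemma davenport_ge:
  assumes "davenport_bound {1..d} n r k" and "1 \<le> d" and "1 \<le> r"
    and n_pos: "\<And>i. i \<in> {1..d} \<Longrightarrow> 0 < n i" and "1 < n d"
  shows "r * n d + (\<Sum>i=1..d-1. n i - 1) \<le> davenport r (cyclic_product d n)"
proof (rule ccontr)
  let ?G = "cyclic_product d n"
  let ?c = "\<lambda>i T. \<Sum>g\<in>#T. g i"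
  define m where "m i = (if i = d then r * n d - 1 else n i - 1)" for i
  define u :: "nat \<Rightarrow> nat \<Rightarrow> int" where "u j = (\<lambda>i\<in>{1..d}. of_bool (i = j))" for j
  define S where "S = (\<Sum>j\<in>{1..d}. replicate_mset (m j) (u j))"
  assume "\<not> ?thesis"
  moreover have "size S = r * n d + (\<Sum>i=1..d-1. n i - 1) - 1"
  proof -
    have split: "{1..d} = insert d {1..d-1}" using assms(2) by auto
    have "size S = (\<Sum>j\<in>{1..d}. m j)" by (simp add: S_def size_multiset_sum)
    also have "\<dots> = m d + (\<Sum>i=1..d-1. m i)"
      unfolding split using assms(2) by (subst sum.insert) auto
    also have "(\<Sum>i=1..d-1. m i) = (\<Sum>i=1..d-1. n i - 1)"
      using assms(2) by (intro sum.cong) (auto simp: m_def)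
    finally show ?thesis using assms(3,5) by (simp add: m_def Suc_leI)
  qed
  ultimately have size: "davenport r ?G \<le> size S" by linarith
  have S_elem: "\<exists>j\<in>{1..d}. g = u j \<and> 0 < m j" if "g \<in># S" for g
    using that by (auto simp: S_def set_mset_sum split: if_splits)
  have over: "seq_over ?G S"
    unfolding seq_over_def
  proof
    fix g assume "g \<in># S"
    then obtain j where j: "j \<in> {1..d}" "g = u j" "0 < m j" using S_elem by blast
    \<comment> \<open>A basis vector occurring in \<open>S\<close> has order above 1, so its entry 1
      is a reduced residue.\<close>
    then have "1 < n j" using assms(5) by (auto simp: m_def split: if_splits)
    then show "g \<in> carrier ?G"
      using j n_pos by (auto simp: cyclic_product_def carrier_integer_mod_group u_def)
  qed
  have nonneg: "0 \<le> ?c i X" if "X \<subseteq># S" "i \<in> {1..d}" for X i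
  proof -
    have "0 \<le> g i" if "g \<in># X" for g
      using S_elem[OF mset_subset_eqD[OF \<open>X \<subseteq># S\<close> that]] \<open>i \<in> {1..d}\<close> by (auto simp: u_def)
    then show ?thesis by (induction X) auto
  qed
  have mono: "?c i X \<le> ?c i Y" if "X \<subseteq># Y" "Y \<subseteq># S" "i \<in> {1..d}" for X Y i
  proof -
    from that(1) obtain Z where Y: "Y = X + Z" by (auto simp: mset_subset_eq_exists_conv)
    then have "Z \<subseteq># Y" by simp
    then have "Z \<subseteq># S" using that(2) by (rule subset_mset.order_trans)
    then have "0 \<le> ?c i Z" using that(3) by (rule nonneg)
    then show ?thesis by (simp add: Y)
  qed
  have c_S: "?c i S = int (m i)" if "i \<in> {1..d}" for i
  proof -
    have "?c i S = (\<Sum>j\<in>{1..d}. if j = i then int (m j) else 0)"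
      unfolding S_def coordinate_sum_sum using that by (intro sum.cong) (auto simp: u_def)
    then show ?thesis using that by simp
  qed
  obtain T where T: "\<And>s. s < r \<Longrightarrow> T s \<noteq> {#} \<and> zero_sum ?G (T s)" "(\<Sum>s<r. T s) \<subseteq># S"
    using has_disjoint_zero_sums_davenport[OF assms(1) over size]
    unfolding has_disjoint_zero_sums_def by blast
  have T_sub: "T s \<subseteq># S" if "s < r" for s
  proof -
    have "T s \<subseteq># (\<Sum>s<r. T s)" using that by (subst sum.remove[of _ s]) auto
    then show ?thesis using T(2) by (rule subset_mset.order_trans)
  qed
  have dvd: "int (n i) dvd ?c i (T s)" if "s < r" "i \<in> {1..d}" for s i
  proof -
    have "seq_over ?G (T s)"
      using over set_mset_mono[OF T_sub[OF that(1)]] unfolding seq_over_def by blast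
    then show ?thesis using T(1)[OF that(1)] that(2) zero_sum_cyclic_product_iff by blast
  qed
  have zero: "?c i (T s) = 0" if "s < r" "i \<in> {1..d}" "?c i (T s) < int (n i)" for s i
    using dvd[OF that(1,2)] nonneg[OF T_sub[OF that(1)] that(2)] that(3) zdvd_not_zless[of "?c i (T s)" "int (n i)"]
    by linarith
  have d: "d \<in> {1..d}" using assms(2) by simp
  \<comment> \<open>Otherwise the \<open>r\<close> subsequences would use at least
    \<open>r * n d\<close> copies of the last basis vector, one more than \<open>S\<close>
    has.\<close>
  have "\<exists>s<r. ?c d (T s) < int (n d)"
  proof (rule ccontr)
    assume "\<not> ?thesis"
    then have "(\<Sum>s<r. int (n d)) \<le> (\<Sum>s<r. ?c d (T s))" by (intro sum_mono) auto
    also have "\<dots> \<le> ?c d S"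
      using mono[OF T(2) subset_mset.order_refl d] unfolding coordinate_sum_sum .
    also have "\<dots> = int (r * n d - 1)" using c_S[OF d] by (simp add: m_def)
    also have "\<dots> < int (r * n d)" using assms(3,5) by simp
    finally show False by simp
  qed
  then obtain s where s: "s < r" "?c d (T s) < int (n d)" by blast
  obtain g where g: "g \<in># T s" using T(1)[OF s(1)] by auto
  then obtain j where j: "j \<in> {1..d}" "g = u j"
    using S_elem mset_subset_eqD[OF T_sub[OF s(1)]] by blast
  \<comment> \<open>Being a multiple of \<open>n j\<close>, this coordinate sum must then be 0,
    although the term \<open>u j\<close> contributes 1 to it.\<close>
  have "?c j (T s) < int (n j)"
  proof (cases "j = d")
    case False
    then have "?c j (T s) \<le> int (n j - 1)"
      using mono[OF T_sub[OF s(1)] subset_mset.order_refl j(1)] c_S[OF j(1)] by (simp add: m_def)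
    then show ?thesis using n_pos[OF j(1)] by linarith
  qed (use s in simp)
  then have "?c j (T s) = 0" using zero s(1) j(1) by blast
  moreover have "?c j {#g#} \<le> ?c j (T s)"
    using g j(1) by (intro mono T_sub[OF s(1)]) auto
  ultimately show False using j by (simp add: u_def)
qed

section \<open>Combining the primes\<close>

lemma phi_eq: "1 \<le> d \<Longrightarrow> phi d q a = (\<Sum>i=1..d-1. int (q ^ a i) - 1)"
  by (simp add: phi_def sum_subtractf of_nat_diff)

text \<open>Induction over the primes: the bound \<open>k\<close> for the earlier primes becomes the
  number of disjoint subsequences requested for the new one.\<close>

lemma davenport_bound_prod:
  fixes p :: "nat \<Rightarrow> nat" and e :: "nat \<Rightarrow> nat \<Rightarrow> nat"
  assumes "1 \<le> d" and "1 \<le> l"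
    and "\<And>j. j \<in> {1..l} \<Longrightarrow> prime (p j)"
    and "\<And>j. j \<in> {1..l} \<Longrightarrow> int (p j ^ e j d) \<ge> 1 + (\<Sum>i=1..d-1. int (p j ^ e j i) - 1)"
  shows "\<exists>k. davenport_bound {1..d} (\<lambda>i. \<Prod>j=1..l. p j ^ e j i) r k \<and>
    int k = int r * (\<Prod>j=1..l. int (p j ^ e j d))
             + (\<Sum>m=1..l-1. (\<Prod>j=m+1..l. int (p j ^ e j d)) * phi d (p m) (e m))
             + phi d (p l) (e l)"
  using assms(2-)
proof (induction l rule: nat_induct_at_least)
  \<comment> \<open>\<open>s\<close> is arbitrary: the base case takes \<open>s = r\<close>, the
    induction step \<open>s = k\<close>.\<close>
  have prime_power: "davenport_bound {1..d} (\<lambda>i. q ^ a i) s (s * q ^ a d + nat (phi d q a)) \<and> phi d q a \<ge> 0"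
    if "prime q" "int (q ^ a d) \<ge> 1 + (\<Sum>i=1..d-1. int (q ^ a i) - 1)" for q s a
  proof -
    have "phi d q a = int (\<Sum>i=1..d-1. q ^ a i - 1)"
      unfolding phi_eq[OF assms(1)] using that(1)
      by (simp add: of_nat_diff prime_gt_0_nat Suc_leI)
    moreover from this that(2) have "q ^ a d \<ge> 1 + (\<Sum>i=1..d-1. q ^ a i - 1)"
      unfolding phi_eq[OF assms(1), symmetric] by linarith
    ultimately show ?thesis
      using davenport_bound_prime_power[OF that(1) assms(1), of a s] by (simp del: of_nat_sum)
  qed
  {
    case base
    then show ?case using prime_power[of "p 1" "e 1" r]
      by (intro exI[of _ "r * p 1 ^ e 1 d + nat (phi d (p 1) (e 1))"]) simp
  next
    case (Suc l)
    let ?q = "p (Suc l)" and ?a = "e (Suc l)"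
    obtain k where k: "davenport_bound {1..d} (\<lambda>i. \<Prod>j=1..l. p j ^ e j i) r k"
      "int k = int r * (\<Prod>j=1..l. int (p j ^ e j d))
             + (\<Sum>m=1..l-1. (\<Prod>j=m+1..l. int (p j ^ e j d)) * phi d (p m) (e m))
             + phi d (p l) (e l)"
      using Suc.IH Suc.prems by fastforce
    have q: "prime ?q" "davenport_bound {1..d} (\<lambda>i. ?q ^ ?a i) k (k * ?q ^ ?a d + nat (phi d ?q ?a))"
      "phi d ?q ?a \<ge> 0"
      using prime_power[of ?q ?a k] Suc.prems by auto
    have "davenport_bound {1..d} (\<lambda>i. \<Prod>j=1..Suc l. p j ^ e j i) r (k * ?q ^ ?a d + nat (phi d ?q ?a))"
      using davenport_bound_mult[OF k(1) q(2)] q(1) by (simp add: prime_gt_0_nat)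
    \<comment> \<open>The new prime power lengthens every product by one factor, and the former last
      \<open>phi\<close> becomes the summand \<open>m = l\<close>.\<close>
    moreover have "int k * int (?q ^ ?a d) = int r * (\<Prod>j=1..Suc l. int (p j ^ e j d))
             + (\<Sum>m=1..l. (\<Prod>j=m+1..Suc l. int (p j ^ e j d)) * phi d (p m) (e m))"
    proof -
      have "(\<Sum>m=1..l. (\<Prod>j=m+1..Suc l. int (p j ^ e j d)) * phi d (p m) (e m)) =
          (\<Sum>m=1..l. (\<Prod>j=m+1..l. int (p j ^ e j d)) * phi d (p m) (e m)) * int (?q ^ ?a d)"
        unfolding sum_distrib_right by (intro sum.cong) (auto simp: algebra_simps)
      also have "(\<Sum>m=1..l. (\<Prod>j=m+1..l. int (p j ^ e j d)) * phi d (p m) (e m)) =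
          (\<Sum>m=1..l-1. (\<Prod>j=m+1..l. int (p j ^ e j d)) * phi d (p m) (e m)) + phi d (p l) (e l)"
        using Suc.hyps by (cases l) auto
      finally show ?thesis
        unfolding k(2) by (simp add: algebra_simps)
    qed
    ultimately show ?case using q(3)
      by (intro exI[of _ "k * ?q ^ ?a d + nat (phi d ?q ?a)"]) simp
  }
qed
theorem theorem6:
  fixes d l r :: nat and p :: "nat \<Rightarrow> nat" and e :: "nat \<Rightarrow> nat \<Rightarrow> nat"
  assumes "1 \<le> d" and "1 \<le> l" and "1 \<le> r"
    and "\<And>j. j \<in> {1..l} \<Longrightarrow> prime (p j)"
    and "inj_on p {1..l}"
    and "\<And>j. j \<in> {1..l} \<Longrightarrow> mono_on {1..d} (e j)"
    and "\<And>j. j \<in> {1..l} \<Longrightarrow> \<exists>i\<in>{1..d}. e j i \<noteq> 0"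
    and "\<And>j. j \<in> {1..l} \<Longrightarrow>
           int (p j ^ e j d) \<ge> 1 + (\<Sum>i=1..d-1. int (p j ^ e j i) - 1)"
  shows "int r * (\<Prod>j=1..l. int (p j ^ e j d))
             + (\<Sum>i=1..d-1. (\<Prod>j=1..l. int (p j ^ e j i)) - 1)
           \<le> int (davenport r (cyclic_product d (\<lambda>i. \<Prod>j=1..l. p j ^ e j i)))
         \<and> int (davenport r (cyclic_product d (\<lambda>i. \<Prod>j=1..l. p j ^ e j i)))
           \<le> int r * (\<Prod>j=1..l. int (p j ^ e j d))
             + (\<Sum>m=1..l-1. (\<Prod>j=m+1..l. int (p j ^ e j d)) * phi d (p m) (e m))
             + phi d (p l) (e l)"
proof -
  let ?n = "\<lambda>i. \<Prod>j=1..l. p j ^ e j i"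
  have pos: "0 < ?n i" for i using assms(4) by (simp add: prod_pos prime_gt_0_nat)
  \<comment> \<open>By monotonicity a nonzero exponent of the first prime makes its last exponent
    nonzero.\<close>
  have n_d: "1 < ?n d"
  proof -
    have 1: "1 \<in> {1..l}" using assms(2) by simp
    obtain i where i: "i \<in> {1..d}" "e 1 i \<noteq> 0" using assms(7)[OF 1] by blast
    have "e 1 i \<le> e 1 d" using assms(6)[OF 1] i(1) by (auto simp: mono_on_def)
    then have "1 < p 1 ^ e 1 d"
      using i(2) prime_gt_1_nat[OF assms(4)[OF 1]] by (intro one_less_power) auto
    moreover have "p 1 ^ e 1 d dvd ?n d"
      using dvd_prodI[of "{1..l}" 1 "\<lambda>j. p j ^ e j d"] 1 by simp
    then have "p 1 ^ e 1 d \<le> ?n d" using pos by (rule dvd_imp_le)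
    ultimately show ?thesis by linarith
  qed
  obtain k where k: "davenport_bound {1..d} ?n r k"
    "int k = int r * (\<Prod>j=1..l. int (p j ^ e j d))
             + (\<Sum>m=1..l-1. (\<Prod>j=m+1..l. int (p j ^ e j d)) * phi d (p m) (e m))
             + phi d (p l) (e l)"
    using davenport_bound_prod[OF assms(1,2), of p e r] assms(4,8) by blast
  have lower: "r * ?n d + (\<Sum>i=1..d-1. ?n i - 1) \<le> davenport r (cyclic_product d ?n)"
    using davenport_ge[OF k(1) assms(1,3) pos n_d] .
  have "int (r * ?n d + (\<Sum>i=1..d-1. ?n i - 1)) =
      int r * (\<Prod>j=1..l. int (p j ^ e j d)) + (\<Sum>i=1..d-1. (\<Prod>j=1..l. int (p j ^ e j i)) - 1)"
    using pos by (simp add: of_nat_diff Suc_leI)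
  \<comment> \<open>With \<open>k = 0\<close> the empty sequence would contain
    \<open>r \<ge> 1\<close> nonempty subsequences.\<close>
  moreover have "0 < k"
  proof (rule ccontr)
    assume "\<not> 0 < k"
    then have "has_disjoint_zero_sums (cyclic_product d ?n) r {#}"
      using has_disjoint_zero_sums_if_davenport_bound[OF k(1), of "{#}"] by (simp add: seq_over_def)
    then obtain T :: "nat \<Rightarrow> (nat \<Rightarrow> int) multiset" where "T 0 \<noteq> {#}" "(\<Sum>s<r. T s) = {#}"
      using assms(3) unfolding has_disjoint_zero_sums_def by auto
    then show False using assms(3) by (simp add: sum_eq_empty_iff)
  qed
  ultimately show ?thesis
    using lower davenport_le[OF k(1)] unfolding k(2)[symmetric] by (simp only: flip: of_nat_le_iff[where 'a = int])
qed

end
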